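(* Let $m$ be a nonzero integer, $m=\varepsilon p_1^{\alpha_1}p_2^{\alpha_2}\cdots p_r^{\alpha_r}$ with $\varepsilon=\pm1$, $p_1,\dots,p_r$ distinct positive primes and all $\alpha_i\ge 1$, and let $x$ be an integer. Let $p_{i_1},\dots,p_{i_t}$ be all the distinct primes which divide $x$ and $m$ simultaneously, and put $d=p_{i_1}^{\alpha_{i_1}}p_{i_2}^{\alpha_{i_2}}\cdots p_{i_t}^{\alpha_{i_t}}$. If $\gcd(x,m/d)=1$, then $$L(x,m)=(x+C_1)(x+C_2)\cdots(x+C_{\varphi(m)})\equiv 0 \pmod{m/d}.$$
   Context: $\varphi$ is Euler's totient function, with $\varphi(-k)=\varphi(k)$. For a nonzero integer $m$, $C_1,\dots,C_{\varphi(m)}$ denotes a reduced residue system modulo $m$ (representatives of all the residue classes modulo $m$ that are relatively prime to $m$), and $L(x,m)=\prod_{i=1}^{\varphi(m)}(x+C_i)$. An empty product equals $1$ (so $d=1$ if no prime divides both $x$ and $m$). *)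

theory Defs
  imports "HOL-Number_Theory.Number_Theory"
begin

definition euler_phi :: "int \<Rightarrow> nat" where
  "euler_phi k = totient (nat \<bar>k\<bar>)"

text \<open>The family \<open>C\<close> is indexed from 1; only its values at \<open>1, \<dots>, \<phi>(m)\<close> matter. They may be
  arbitrary integers, not necessarily least residues.\<close>

definition reduced_residue_system :: "int \<Rightarrow> (nat \<Rightarrow> int) \<Rightarrow> bool" where
  "reduced_residue_system m C \<longleftrightarrow>
     (\<forall>i\<in>{1..euler_phi m}. coprime (C i) m) \<and>
     (\<forall>a. coprime a m \<longrightarrow> (\<exists>!i. i \<in> {1..euler_phi m} \<and> [C i = a] (mod m)))"

definition L :: "(nat \<Rightarrow> int) \<Rightarrow> int \<Rightarrow> int \<Rightarrow> int" where
  "L C x m = (\<Prod>i = 1..euler_phi m. x + C i)"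

end

theory Submission
  imports Defs
begin

text \<open>Since \<open>d\<close> and \<open>m / d\<close> are coprime, some \<open>a\<close> satisfies \<open>a \<equiv> -x\<close> modulo \<open>m / d\<close> and
  \<open>a \<equiv> 1\<close> modulo \<open>d\<close>. It is coprime to \<open>m\<close>, so some \<open>C\<^sub>i\<close> is congruent to \<open>a\<close> modulo \<open>m\<close>, and the
  single factor \<open>x + C\<^sub>i\<close> is already divisible by \<open>m / d\<close>.\<close>

text \<open>Injectivity of \<open>p\<close> on the union gives disjoint index sets distinct primes.
  \<open>prime\<close> on \<open>int\<close> includes positivity, so distinct primes are never
  associates like 2 and -2.\<close>

lemma coprime_prod_prime_powers_disjoint:
  fixes p :: "'i \<Rightarrow> int"
  assumes "\<And>i. i \<in> A \<union> B \<Longrightarrow> prime (p i)" and "inj_on p (A \<union> B)" and "A \<inter> B = {}"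
  shows "coprime (\<Prod>i\<in>A. p i ^ k i) (\<Prod>i\<in>B. p i ^ k i)"
proof (intro prod_coprime_left prod_coprime_right)
  fix i j assume ij: "i \<in> A" "j \<in> B"
  with assms(2,3) have "p i \<noteq> p j"
    by (auto dest: inj_onD)
  with ij assms(1) have "coprime (p i) (p j)"
    by (intro primes_coprime) auto
  then show "coprime (p i ^ k i) (p j ^ k j)"
    by simp
qed

lemma L_cong_0_coprime_factor:
  assumes C: "reduced_residue_system (d * e) C" and de: "coprime d e" and xe: "coprime x e"
  shows "[L C x (d * e) = 0] (mod e)"
proof -
  obtain u where u: "[d * u = 1] (mod e)"
    using cong_solve_coprime_int[OF de] by blast
  \<comment> \<open>Explicit Chinese remainder solution: \<open>d * u\<close> is 0 modulo
    \<open>d\<close> and 1 modulo \<open>e\<close>, so it switches the correction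
    \<open>- x - 1\<close> off modulo \<open>d\<close> and on modulo \<open>e\<close>.\<close>
  define a where "a = 1 + d * u * (- x - 1)"
  have "[a = 1 + 1 * (- x - 1)] (mod e)"
    unfolding a_def using u by (intro cong_add cong_mult cong_refl)
  then have a: "[a = - x] (mod e)"
    by simp
  have "coprime a e"
    using cong_imp_coprime[OF cong_sym[OF a]] xe by simp
  moreover have "coprime a d"
  proof -
    have "[1 = a] (mod d)"
      by (simp add: a_def cong_iff_dvd_diff)
    from cong_imp_coprime[OF this] show ?thesis by simp
  qed
  ultimately have "coprime a (d * e)"
    by simp
  with C obtain i where i: "i \<in> {1..euler_phi (d * e)}" "[C i = a] (mod d * e)"
    unfolding reduced_residue_system_def by blast
  have "[C i = a] (mod e)"
    using i(2) by (rule cong_dvd_modulus) simp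
  then have "[x + C i = x + - x] (mod e)"
    using a by (intro cong_add cong_refl) (rule cong_trans)
  then have "e dvd x + C i"
    by (simp add: cong_0_iff)
  also have "x + C i dvd L C x (d * e)"
    unfolding L_def using i(1) by (intro dvd_prodI) auto
  finally show ?thesis
    by (simp add: cong_0_iff)
qed

theorem theorem5p23:
  fixes m x d \<epsilon> :: int and r :: nat and p :: "nat \<Rightarrow> int" and \<alpha> :: "nat \<Rightarrow> nat"
    and C :: "nat \<Rightarrow> int"
  assumes "m \<noteq> 0"
    and "\<epsilon> = 1 \<or> \<epsilon> = -1"
    and "\<And>i. i \<in> {1..r} \<Longrightarrow> prime (p i)"
    and "inj_on p {1..r}"
    and "\<And>i. i \<in> {1..r} \<Longrightarrow> \<alpha> i \<ge> 1"
    and "m = \<epsilon> * (\<Prod>i = 1..r. p i ^ \<alpha> i)"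
    and "d = (\<Prod>i \<in> {i \<in> {1..r}. p i dvd x \<and> p i dvd m}. p i ^ \<alpha> i)"
    and "reduced_residue_system m C"
    and "gcd x (m div d) = 1"
  shows "[L C x m = 0] (mod (m div d))"
proof -
  define A where "A = {i \<in> {1..r}. p i dvd x \<and> p i dvd m}"
  \<comment> \<open>The prime powers left out of \<open>d\<close>; \<open>q\<close> is
    \<open>m div d\<close> up to the sign \<open>\<epsilon>\<close>.\<close>
  define q where "q = (\<Prod>i\<in>{1..r} - A. p i ^ \<alpha> i)"
  have A: "A \<subseteq> {1..r}"
    by (auto simp: A_def)
  have d: "d = (\<Prod>i\<in>A. p i ^ \<alpha> i)"
    by (simp add: assms(7) A_def)
  have "(\<Prod>i = 1..r. p i ^ \<alpha> i) = q * d"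
    unfolding q_def d using A by (intro prod.subset_diff) auto
  with assms(6) have m: "m = d * (\<epsilon> * q)"
    by simp
  \<comment> \<open>The division is exact, and \<open>d\<close> is nonzero because it divides
    \<open>m \<noteq> 0\<close>.\<close>
  with assms(1) have e: "m div d = \<epsilon> * q"
    by auto
  have "coprime d q"
    unfolding d q_def using A assms(3,4)
    by (intro coprime_prod_prime_powers_disjoint) (auto simp: Un_absorb1)
  \<comment> \<open>The sign \<open>\<epsilon>\<close> is a unit, so it does not affect
    coprimality.\<close>
  with assms(2) have "coprime d (\<epsilon> * q)"
    by auto
  with assms(8,9) show ?thesis
    unfolding e using L_cong_0_coprime_factor[of d "\<epsilon> * q" C x] m
    by (simp add: coprime_iff_gcd_eq_1)
qed

end
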